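(* Let $M,I_1,\dots,I_M,d$ be positive integers with $d\le I_1\cdots I_M$. Let $\mathcal{A},\mathcal{B}\in\mathbb{R}^{I_1\times\cdots\times I_M\times I_1\times\cdots\times I_M}$ be symmetric tensors, with $\mathcal{B}$ positive semi-definite and $\dim\mathcal{N}(\mathcal{B})<d$. Let $\rho^*$ be the maximum value, and $\mathcal{P}^*$ a maximizer, of $$\frac{\operatorname{Tr}\left(\mathcal{P}^T*_M\mathcal{A}*_M\mathcal{P}\right)}{\operatorname{Tr}\left(\mathcal{P}^T*_M\mathcal{B}*_M\mathcal{P}\right)}$$ over all $\mathcal{P}\in\mathbb{R}^{I_1\times\cdots\times I_M\times d}$ with $\mathcal{P}^T*_M\mathcal{P}=I_d$, and let $g(\rho^* )=\mathcal{A}-\rho^*\mathcal{B}$. Then $$\max_{\mathcal{P}^T*_M\mathcal{P}=I_d}\operatorname{Tr}\left(\mathcal{P}^T*_M g(\rho^* )*_M\mathcal{P}\right)=\operatorname{Tr}\left((\mathcal{P}^* )^T*_M g(\rho^* )*_M\mathcal{P}^*\right)=0,$$ the maximum being over $\mathcal{P}\in\mathbb{R}^{I_1\times\cdots\times I_M\times d}$.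
   Context: The Einstein product $*_N$ of two tensors contracts the last $N$ modes of the first with the first $N$ modes of the second: $(\mathcal{A}*_N\mathcal{Z})_{i_1\ldots j_1\ldots}=\sum_{k_1,\ldots,k_N}\mathcal{A}_{i_1\ldots k_1\ldots k_N}\mathcal{Z}_{k_1\ldots k_N j_1\ldots}$. For $\mathcal{P}\in\mathbb{R}^{I_1\times\cdots\times I_M\times d}$, the transpose $\mathcal{P}^T\in\mathbb{R}^{d\times I_1\times\cdots\times I_M}$ is $(\mathcal{P}^T)_{j i_1\ldots i_M}=\mathcal{P}_{i_1\ldots i_M j}$; hence $\mathcal{P}^T*_M\mathcal{A}*_M\mathcal{P}$ is a $d\times d$ matrix and $\operatorname{Tr}$ is the matrix trace. For $\mathcal{A}\in\mathbb{R}^{I_1\times\cdots\times I_M\times I_1\times\cdots\times I_M}$, $(\mathcal{A}^T)_{j_1\ldots j_M i_1\ldots i_M}=\mathcal{A}_{i_1\ldots i_M j_1\ldots j_M}$, and $\mathcal{A}$ is symmetric if $\mathcal{A}^T=\mathcal{A}$. Such a tensor is positive semi-definite if $\langle\mathcal{X},\mathcal{A}*_M\mathcal{X}\rangle\ge 0$ for all $\mathcal{X}\in\mathbb{R}^{I_1\times\cdots\times I_M}$, where $\langle\cdot,\cdot\rangle$ is the entrywise (Frobenius) inner product. The null space is $\mathcal{N}(\mathcal{B})=\{\mathcal{X}\in\mathbb{R}^{I_1\times\cdots\times I_M}:\mathcal{B}*_M\mathcal{X}=0\}$. *)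

theory Defs
  imports "HOL-Analysis.Analysis" "HOL-Library.Function_Algebras"
begin

text \<open>Pointwise scalar multiplication; addition and subtraction of functions come from
  \<^theory>\<open>HOL-Library.Function_Algebras\<close>.\<close>

instantiation "fun" :: (type, real_vector) real_vector
begin

definition scaleR_fun :: "real \<Rightarrow> ('a \<Rightarrow> 'b) \<Rightarrow> 'a \<Rightarrow> 'b" where
  "scaleR_fun c f = (\<lambda>x. c *\<^sub>R f x)"

instance
  by standard (auto simp: scaleR_fun_def fun_eq_iff algebra_simps)

end

text \<open>A multi-index is a list of natural numbers, counted from 0. A real tensor of shape
  \<open>[I\<^sub>1, \<dots>, I\<^sub>M]\<close> is a function on lists that vanishes outside the multi-indices of that shape.
  Equality of two tensors of the same shape is then equality of functions, and the tensors of a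
  given shape form a subspace of the real vector space of functions.\<close>

type_synonym tensor = "nat list \<Rightarrow> real"

definition multi_indices :: "nat list \<Rightarrow> nat list set" where
  "multi_indices Is = {is. list_all2 (<) is Is}"

definition tensors :: "nat list \<Rightarrow> tensor set" where
  "tensors Is = {T. \<forall>is. is \<notin> multi_indices Is \<longrightarrow> T is = 0}"

text \<open>\<open>einstein_prod m Ks A Z\<close> is the Einstein product \<open>A *\<^sub>N Z\<close> with \<open>N = length Ks\<close>, where \<open>A\<close> has
  shape \<open>Is @ Ks\<close> with \<open>length Is = m\<close>, and \<open>Z\<close> has shape \<open>Ks @ Js\<close>: a multi-index of the result
  is split as \<open>is @ js\<close> after its first \<open>m\<close> entries.\<close>

definition einstein_prod :: "nat \<Rightarrow> nat list \<Rightarrow> tensor \<Rightarrow> tensor \<Rightarrow> tensor" where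
  "einstein_prod m Ks A Z =
     (\<lambda>l. \<Sum>ks\<in>multi_indices Ks. A (take m l @ ks) * Z (ks @ drop m l))"

text \<open>\<open>tensor_transpose n T\<close> moves the last \<open>n\<close> modes of \<open>T\<close> to the front: its value at \<open>js @ is\<close>
  with \<open>length js = n\<close> is \<open>T (is @ js)\<close>. The case \<open>n = 1\<close> is the transpose of a tensor of shape
  \<open>Is @ [d]\<close>, and \<open>n = length Is\<close> that of a tensor of shape \<open>Is @ Is\<close>.\<close>

definition tensor_transpose :: "nat \<Rightarrow> tensor \<Rightarrow> tensor" where
  "tensor_transpose n T = (\<lambda>l. T (drop n l @ take n l))"

definition symmetric_tensor :: "nat \<Rightarrow> tensor \<Rightarrow> bool" where
  "symmetric_tensor M A \<longleftrightarrow> tensor_transpose M A = A"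

definition tensor_inner :: "nat list \<Rightarrow> tensor \<Rightarrow> tensor \<Rightarrow> real" where
  "tensor_inner Is X Y = (\<Sum>is\<in>multi_indices Is. X is * Y is)"

definition pos_semidef :: "nat list \<Rightarrow> tensor \<Rightarrow> bool" where
  "pos_semidef Is A \<longleftrightarrow>
     (\<forall>X\<in>tensors Is. tensor_inner Is X (einstein_prod (length Is) Is A X) \<ge> 0)"

definition null_space :: "nat list \<Rightarrow> tensor \<Rightarrow> tensor set" where
  "null_space Is B = {X \<in> tensors Is. einstein_prod (length Is) Is B X = 0}"

text \<open>A \<open>d \<times> d\<close> matrix is a tensor of shape \<open>[d, d]\<close>.\<close>

definition identity_matrix :: "nat \<Rightarrow> tensor" where
  "identity_matrix d = (\<lambda>l. if \<exists>i<d. l = [i, i] then 1 else 0)"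

definition matrix_trace :: "nat \<Rightarrow> tensor \<Rightarrow> real" where
  "matrix_trace d T = (\<Sum>i<d. T [i, i])"

text \<open>The set of all \<open>P\<close> of shape \<open>Is @ [d]\<close> with \<open>P\<^sup>T *\<^sub>M P = I\<^sub>d\<close>.\<close>

definition orthonormal_tensors :: "nat list \<Rightarrow> nat \<Rightarrow> tensor set" where
  "orthonormal_tensors Is d =
     {P \<in> tensors (Is @ [d]). einstein_prod 1 Is (tensor_transpose 1 P) P = identity_matrix d}"

text \<open>\<open>Tr (P\<^sup>T *\<^sub>M A *\<^sub>M P)\<close>\<close>

definition trace_form :: "nat list \<Rightarrow> nat \<Rightarrow> tensor \<Rightarrow> tensor \<Rightarrow> real" where
  "trace_form Is d A P =
     matrix_trace d (einstein_prod 1 Is (einstein_prod 1 Is (tensor_transpose 1 P) A) P)"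

text \<open>The operations above need no explicit guards: they respect shapes.\<close>

lemma tensor_transpose_in_tensors:
  assumes "T \<in> tensors (Is @ Js)"
  shows "tensor_transpose (length Js) T \<in> tensors (Js @ Is)"
proof -
  have "l \<in> multi_indices (Js @ Is)"
    if "drop (length Js) l @ take (length Js) l \<in> multi_indices (Is @ Js)" for l
  proof -
    have len: "length l = length Is + length Js"
      using that by (auto simp: multi_indices_def dest!: list_all2_lengthD)
    have "list_all2 (<) (drop (length Js) l) Is" "list_all2 (<) (take (length Js) l) Js"
      using that len by (auto simp: multi_indices_def list_all2_append)
    then have "list_all2 (<) (take (length Js) l @ drop (length Js) l) (Js @ Is)"
      by (intro list_all2_appendI)
    then show ?thesis by (simp add: multi_indices_def)
  qed
  then show ?thesis
    using assms unfolding tensors_def tensor_transpose_def by blast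
qed

lemma einstein_prod_in_tensors:
  assumes "A \<in> tensors (Is @ Ks)" "Z \<in> tensors (Ks @ Js)"
  shows "einstein_prod (length Is) Ks A Z \<in> tensors (Is @ Js)"
proof -
  have "A (take (length Is) l @ ks) * Z (ks @ drop (length Is) l) = 0"
    if l: "l \<notin> multi_indices (Is @ Js)" and ks: "ks \<in> multi_indices Ks" for l ks
  proof (rule ccontr)
    assume "A (take (length Is) l @ ks) * Z (ks @ drop (length Is) l) \<noteq> 0"
    then have "take (length Is) l @ ks \<in> multi_indices (Is @ Ks)"
      and "ks @ drop (length Is) l \<in> multi_indices (Ks @ Js)"
      using assms unfolding tensors_def by auto
    moreover have "length ks = length Ks"
      using ks by (auto simp: multi_indices_def dest: list_all2_lengthD)
    ultimately have "list_all2 (<) (take (length Is) l) Is" "list_all2 (<) (drop (length Is) l) Js"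
      by (auto simp: multi_indices_def list_all2_append list_all2_append2
          dest: list_all2_lengthD)
    then have "list_all2 (<) (take (length Is) l @ drop (length Is) l) (Is @ Js)"
      by (intro list_all2_appendI)
    then show False using l by (simp add: multi_indices_def)
  qed
  then show ?thesis
    by (simp add: tensors_def einstein_prod_def sum.neutral)
qed

end

theory Submission
  imports Defs
begin

text \<open>Write \<open>p\<^sub>j\<close> for the slice \<open>is \<mapsto> P (is @ [j])\<close>. Then \<open>Tr (P\<^sup>T *\<^sub>M A *\<^sub>M P)\<close> is the sum over
  \<open>j < d\<close> of \<open>\<langle>p\<^sub>j, A *\<^sub>M p\<^sub>j\<rangle>\<close> (\<open>trace_form_slices\<close>), and it is linear in \<open>A\<close>. The constraint says
  that the \<open>p\<^sub>j\<close> are orthonormal.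

  The denominator of the quotient is positive on the whole feasible set (\<open>trace_form_pos\<close>):
  it is a sum of nonnegative terms \<open>\<langle>p\<^sub>j, B *\<^sub>M p\<^sub>j\<rangle>\<close>, and if it vanished, then each term would vanish,
  which for a symmetric positive semi-definite \<open>B\<close> forces \<open>B *\<^sub>M p\<^sub>j = 0\<close>
  (\<open>pos_semidef_isotropic_in_null_space\<close>). The null space would then contain \<open>d\<close> independent
  elements, against the bound on its dimension.

  Given positivity, the theorem is Dinkelbach's observation: \<open>f P / h P \<le> \<rho>\<close> is equivalent to
  \<open>f P - \<rho> * h P \<le> 0\<close>, with equality in one exactly when there is equality in the other.\<close>

section \<open>The bilinear form of a tensor\<close>

lemma length_multi_indices: "is \<in> multi_indices Is \<Longrightarrow> length is = length Is"
  by (auto simp: multi_indices_def dest: list_all2_lengthD)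

lemma finite_multi_indices: "finite (multi_indices Is)"
proof (rule finite_subset)
  show "multi_indices Is \<subseteq> {l. set l \<subseteq> {..sum_list Is} \<and> length l = length Is}"
  proof
    fix l assume l: "l \<in> multi_indices Is"
    then have "l ! i \<le> sum_list Is" if "i < length l" for i
      using that member_le_sum_list[OF nth_mem, of i Is]
      by (fastforce simp: multi_indices_def list_all2_conv_all_nth)
    with l show "l \<in> {l. set l \<subseteq> {..sum_list Is} \<and> length l = length Is}"
      by (auto simp: length_multi_indices in_set_conv_nth)
  qed
  show "finite {l. set l \<subseteq> {..sum_list Is} \<and> length l = length Is}"
    by (rule finite_lists_length_eq) simp
qed

definition tensor_form :: "nat list \<Rightarrow> tensor \<Rightarrow> tensor \<Rightarrow> tensor \<Rightarrow> real" where
  "tensor_form Is A X Y =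
     (\<Sum>is\<in>multi_indices Is. \<Sum>ks\<in>multi_indices Is. X is * A (is @ ks) * Y ks)"

lemma tensor_form_eq_inner:
  "tensor_form Is A X Y = tensor_inner Is X (einstein_prod (length Is) Is A Y)"
  unfolding tensor_form_def tensor_inner_def einstein_prod_def
  by (rule sum.cong) (auto simp: length_multi_indices sum_distrib_left mult.assoc)

lemma tensor_form_diff:
  "tensor_form Is (A - c *\<^sub>R B) X Y = tensor_form Is A X Y - c * tensor_form Is B X Y"
  by (simp add: tensor_form_def scaleR_fun_def algebra_simps sum_subtractf sum_distrib_left)

lemma tensor_form_add_left:
  "tensor_form Is A (X + c *\<^sub>R Y) Z = tensor_form Is A X Z + c * tensor_form Is A Y Z"
  by (simp add: tensor_form_def scaleR_fun_def algebra_simps sum.distrib sum_distrib_left)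

lemma tensor_form_add_right:
  "tensor_form Is A Z (X + c *\<^sub>R Y) = tensor_form Is A Z X + c * tensor_form Is A Z Y"
  by (simp add: tensor_form_def scaleR_fun_def algebra_simps sum.distrib sum_distrib_left)

lemma tensor_form_commute:
  assumes "symmetric_tensor (length Is) A"
  shows "tensor_form Is A X Y = tensor_form Is A Y X"
proof -
  have "A (is @ ks) = A (ks @ is)" if "is \<in> multi_indices Is" for "is" ks
    using fun_cong[OF assms[unfolded symmetric_tensor_def], of "is @ ks"] that
    by (simp add: tensor_transpose_def length_multi_indices)
  then show ?thesis
    unfolding tensor_form_def by (subst sum.swap) (auto intro!: sum.cong simp: mult_ac)
qed

text \<open>The usual Cauchy--Schwarz argument: with \<open>Y = B *\<^sub>M X\<close>, the quadratic polynomial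
  \<open>t \<mapsto> \<langle>X + t Y, B *\<^sub>M (X + t Y)\<rangle>\<close> is nonnegative and has no constant term, so that its linear
  coefficient \<open>2 \<langle>Y, Y\<rangle>\<close> vanishes.\<close>

lemma pos_semidef_isotropic_in_null_space:
  assumes B: "B \<in> tensors (Is @ Is)" "symmetric_tensor (length Is) B" "pos_semidef Is B"
    and X: "X \<in> tensors Is" and zero: "tensor_form Is B X X = 0"
  shows "X \<in> null_space Is B"
proof -
  define Y where "Y = einstein_prod (length Is) Is B X"
  have Y: "Y \<in> tensors Is"
    using einstein_prod_in_tensors[of B Is Is X "[]"] B X by (simp add: Y_def)
  define a where "a = tensor_form Is B Y X"
  define c where "c = tensor_form Is B Y Y"
  have nonneg: "tensor_form Is B Z Z \<ge> 0" if "Z \<in> tensors Is" for Z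
    using B(3) that by (simp add: pos_semidef_def tensor_form_eq_inner)
  have c: "c \<ge> 0"
    using nonneg[OF Y] by (simp add: c_def)
  have expand: "0 \<le> 2 * t * a + t\<^sup>2 * c" for t
  proof -
    have "X + t *\<^sub>R Y \<in> tensors Is"
      using X Y by (simp add: tensors_def scaleR_fun_def)
    from nonneg[OF this] show ?thesis
      by (simp add: tensor_form_add_left tensor_form_add_right zero a_def c_def
          tensor_form_commute[OF B(2), of X Y] algebra_simps power2_eq_square)
  qed
  \<comment> \<open>Any negative multiple of \<open>a\<close> with factor below \<open>2 / c\<close> gives the contradiction; \<open>1 / (c + 1)\<close>
    also covers \<open>c = 0\<close>.\<close>
  have "2 * (- a / (c + 1)) * a + (- a / (c + 1))\<^sup>2 * c = - (a\<^sup>2 * (c + 2) / (c + 1)\<^sup>2)"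
    using c by (simp add: divide_simps power2_eq_square) algebra
  with expand[of "- a / (c + 1)"] have "a\<^sup>2 * (c + 2) / (c + 1)\<^sup>2 \<le> 0"
    by linarith
  then have "a = 0"
    using c by (simp add: divide_le_0_iff mult_le_0_iff)
  then have "(\<Sum>is\<in>multi_indices Is. Y is * Y is) = 0"
    by (simp add: a_def tensor_form_eq_inner tensor_inner_def flip: Y_def)
  then have "Y is = 0" if "is \<in> multi_indices Is" for "is"
    using that finite_multi_indices by (subst (asm) sum_nonneg_eq_0_iff) auto
  with Y have "Y = 0"
    by (auto simp: tensors_def fun_eq_iff)
  with X show ?thesis
    by (simp add: null_space_def Y_def)
qed

section \<open>Slices along the last mode\<close>

definition slice :: "tensor \<Rightarrow> nat \<Rightarrow> tensor" where
  "slice P j = (\<lambda>is. P (is @ [j]))"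

lemma slice_in_tensors:
  assumes "P \<in> tensors (Is @ [d])"
  shows "slice P j \<in> tensors Is"
proof -
  have "l \<in> multi_indices Is" if "l @ [j] \<in> multi_indices (Is @ [d])" for l
    using that length_multi_indices[OF that] by (simp add: multi_indices_def list_all2_append)
  with assms show ?thesis
    unfolding tensors_def slice_def by blast
qed

lemma trace_form_slices: "trace_form Is d A P = (\<Sum>j<d. tensor_form Is A (slice P j) (slice P j))"
  unfolding trace_form_def matrix_trace_def tensor_form_def
proof (rule sum.cong[OF refl])
  fix j
  show "einstein_prod 1 Is (einstein_prod 1 Is (tensor_transpose 1 P) A) P [j, j] =
    (\<Sum>is\<in>multi_indices Is. \<Sum>ks\<in>multi_indices Is. slice P j is * A (is @ ks) * slice P j ks)"
    by (subst sum.swap)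
      (simp add: einstein_prod_def tensor_transpose_def slice_def sum_distrib_right)
qed

lemma slices_orthonormal:
  assumes "P \<in> orthonormal_tensors Is d" "i < d" "j < d"
  shows "tensor_inner Is (slice P i) (slice P j) = (if i = j then 1 else 0)"
proof -
  have "einstein_prod 1 Is (tensor_transpose 1 P) P [i, j] = identity_matrix d [i, j]"
    using assms(1) by (simp add: orthonormal_tensors_def)
  then show ?thesis
    using assms(2,3)
    by (auto simp: einstein_prod_def tensor_transpose_def identity_matrix_def tensor_inner_def
        slice_def)
qed

lemma inj_on_slices:
  assumes "P \<in> orthonormal_tensors Is d"
  shows "inj_on (slice P) {..<d}"
proof (rule inj_onI)
  fix i j assume "i \<in> {..<d}" "j \<in> {..<d}" "slice P i = slice P j"
  then show "i = j"
    using slices_orthonormal[OF assms, of i i] slices_orthonormal[OF assms, of i j]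
    by (auto split: if_splits)
qed

lemma independent_slices:
  assumes "P \<in> orthonormal_tensors Is d"
  shows "independent (slice P ` {..<d})"
proof (subst independent_explicit_finite_subsets, intro allI impI ballI)
  fix S u v
  assume S: "S \<subseteq> slice P ` {..<d}" "finite S" and comb: "(\<Sum>w\<in>S. u w *\<^sub>R w) = 0" and v: "v \<in> S"
  have pair: "tensor_inner Is v w = (if w = v then 1 else 0)" if "w \<in> S" for w
    using S(1) v that slices_orthonormal[OF assms] inj_on_slices[OF assms]
    by (auto simp: inj_on_def subset_iff image_iff) (metis lessThan_iff)+
  have eval: "(\<Sum>w\<in>T. u w *\<^sub>R w) is = (\<Sum>w\<in>T. u w * w is)" if "finite T" for T "is"
    using that by induction (auto simp: scaleR_fun_def)
  have "0 = tensor_inner Is v (\<Sum>w\<in>S. u w *\<^sub>R w)"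
    by (simp add: comb tensor_inner_def)
  also have "\<dots> = (\<Sum>w\<in>S. u w * tensor_inner Is v w)"
    unfolding tensor_inner_def eval[OF S(2)] sum_distrib_left
    by (subst sum.swap) (simp add: mult_ac)
  also have "\<dots> = u v"
    using S(2) v by (simp add: pair if_distrib[of "(*) _"] cong: if_cong)
  finally show "u v = 0" by simp
qed

section \<open>Dimension of the null space\<close>

lemma tensors_finitely_spanned:
  "\<exists>F. finite F \<and> tensors Is \<subseteq> span F"
proof (intro exI conjI subsetI)
  let ?e = "\<lambda>ks l. if l = ks then 1 else 0 :: real"
  show "finite (?e ` multi_indices Is)"
    by (simp add: finite_multi_indices)
  fix X assume X: "X \<in> tensors Is"
  have eval: "(\<Sum>ks\<in>T. X ks *\<^sub>R ?e ks) l = (if l \<in> T then X l else 0)" if "finite T" for T l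
    using that by induction (auto simp: scaleR_fun_def)
  have "X = (\<Sum>ks\<in>multi_indices Is. X ks *\<^sub>R ?e ks)"
    using X by (auto simp: fun_eq_iff eval finite_multi_indices tensors_def)
  also have "\<dots> \<in> span (?e ` multi_indices Is)"
    by (intro span_sum span_scale span_base) auto
  finally show "X \<in> span (?e ` multi_indices Is)" .
qed

text \<open>The type of all tensors has infinite dimension, and \<open>dim\<close> defaults to 0 on a set without a finite
  basis; the finite spanning set excludes this case.\<close>

lemma card_le_dim_finitely_spanned:
  fixes V :: "'a::real_vector set"
  assumes "finite F" "V \<subseteq> span F" "independent S" "S \<subseteq> V"
  shows "card S \<le> dim V"
proof -
  obtain E where E: "E \<subseteq> V" "independent E" "V \<subseteq> span E" "card E = dim V"
    using basis_exists by blast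
  have "finite E"
    using independent_span_bound[OF assms(1) E(2)] E(1) assms(2) by auto
  then have "card S \<le> card E"
    using independent_span_bound[of E S] assms(3,4) E(3) by auto
  with E(4) show ?thesis by simp
qed

lemma trace_form_pos:
  assumes B: "B \<in> tensors (Is @ Is)" "symmetric_tensor (length Is) B" "pos_semidef Is B"
    and dim: "dim (null_space Is B) < d" and P: "P \<in> orthonormal_tensors Is d"
  shows "trace_form Is d B P > 0"
proof (rule ccontr)
  assume not_pos: "\<not> ?thesis"
  have tens: "slice P j \<in> tensors Is" for j
    using P by (auto simp: orthonormal_tensors_def intro: slice_in_tensors)
  then have nonneg: "tensor_form Is B (slice P j) (slice P j) \<ge> 0" for j
    using B(3) by (simp add: pos_semidef_def tensor_form_eq_inner)
  then have "(\<Sum>j<d. tensor_form Is B (slice P j) (slice P j)) = 0"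
    using not_pos by (simp add: trace_form_slices order_antisym sum_nonneg)
  then have "tensor_form Is B (slice P j) (slice P j) = 0" if "j < d" for j
    using that nonneg by (simp add: sum_nonneg_eq_0_iff)
  then have sub: "slice P ` {..<d} \<subseteq> null_space Is B"
    using pos_semidef_isotropic_in_null_space[OF B tens] by auto
  obtain F where "finite F" "tensors Is \<subseteq> span F"
    using tensors_finitely_spanned by blast
  moreover from this have "null_space Is B \<subseteq> span F"
    by (auto simp: null_space_def)
  ultimately have "card (slice P ` {..<d}) \<le> dim (null_space Is B)"
    using card_le_dim_finitely_spanned independent_slices[OF P] sub by blast
  with dim show False
    by (simp add: card_image inj_on_slices[OF P])
qed

section \<open>The trace ratio problem\<close>

theorem mainTheorem3:
  fixes M d :: nat and Is :: "nat list" and A B Pstar :: tensor and rho :: real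
  assumes "M > 0" and "length Is = M" and "\<forall>n\<in>set Is. n > 0"
    and "d > 0" and "d \<le> prod_list Is"
    and "A \<in> tensors (Is @ Is)" and "symmetric_tensor M A"
    and "B \<in> tensors (Is @ Is)" and "symmetric_tensor M B"
    and "pos_semidef Is B" and "dim (null_space Is B) < d"
    and "is_arg_max (\<lambda>P. trace_form Is d A P / trace_form Is d B P)
           (\<lambda>P. P \<in> orthonormal_tensors Is d) Pstar"
    and "rho = trace_form Is d A Pstar / trace_form Is d B Pstar"
  shows "is_arg_max (trace_form Is d (A - rho *\<^sub>R B))
           (\<lambda>P. P \<in> orthonormal_tensors Is d) Pstar
         \<and> trace_form Is d (A - rho *\<^sub>R B) Pstar = 0"
proof -
  let ?f = "trace_form Is d A" and ?h = "trace_form Is d B"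
  have diff: "trace_form Is d (A - rho *\<^sub>R B) P = ?f P - rho * ?h P" for P
    by (simp add: trace_form_slices tensor_form_diff sum_subtractf sum_distrib_left)
  have pos: "?h P > 0" if "P \<in> orthonormal_tensors Is d" for P
    using trace_form_pos assms that by blast
  have Pstar: "Pstar \<in> orthonormal_tensors Is d"
    using assms(12) by (simp add: is_arg_max_def)
  have max: "?f P / ?h P \<le> rho" if "P \<in> orthonormal_tensors Is d" for P
    using assms(12,13) that by (auto simp: is_arg_max_def not_less)
  have zero: "?f Pstar - rho * ?h Pstar = 0"
    using pos[OF Pstar] assms(13) by simp
  have "?f P - rho * ?h P \<le> 0" if "P \<in> orthonormal_tensors Is d" for P
    using max[OF that] pos[OF that] by (simp add: pos_divide_le_eq)
  with Pstar zero show ?thesis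
    by (auto simp: is_arg_max_def diff not_less)
qed

end
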